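(* Let $G$ and $H$ be graphs. If both $G$ and $H$ are R-cores and $G\backsim_w H$ (that is, they lie in the same equivalence class of weak relational equivalence), then $G$ and $H$ are isomorphic.
   Context: Graphs are finite and undirected, with loops allowed: $G=(V_G,E_G)$ with $E_G\subseteq V_G\times V_G$ symmetric. A relation $R\subseteq X\times Y$ has full domain if every $x\in X$ is related to some $p\in Y$, and full image if every $p\in Y$ is related to by some $x\in X$. For a graph $G$, a finite set $B$ and a relation $R\subseteq V_G\times B$ with full image, $G\ast R$ is the graph with vertex set $B$ and edge set $\{(u,v)\in B\times B : \text{there is } (x,y)\in E_G \text{ with } (x,u),(y,v)\in R\}$. The equation $G\ast R=H$ means that $R\subseteq V_G\times V_H$ has full image and $G\ast R$ equals $H$ as a graph. Graphs $G,H$ are weakly relationally equivalent, $G\backsim_w H$, if there are relations $R\subseteq V_G\times V_H$ and $S\subseteq V_H\times V_G$, both with full domain, such that $G\ast R=H$ and $H\ast S=G$. This is an equivalence relation on graphs. A graph is an R-core if it has the smallest number of vertices among all graphs in its $\backsim_w$-equivalence class. *)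

theory Defs
  imports "Graph_Theory.Pair_Digraph" "Graph_Theory.Digraph_Isomorphism"
begin

text \<open>
  A finite undirected graph, loops allowed, is a pair digraph \<open>G\<close> with \<open>pair_pseudo_graph G\<close>:
  \<open>pverts G\<close> is finite, and \<open>parcs G\<close> is a symmetric subset of \<open>pverts G \<times> pverts G\<close>.
\<close>

definition full_domain :: "('a \<times> 'b) set \<Rightarrow> 'a set \<Rightarrow> 'b set \<Rightarrow> bool" where
  "full_domain R X Y \<longleftrightarrow> (\<forall>x\<in>X. \<exists>p\<in>Y. (x, p) \<in> R)"

definition full_image :: "('a \<times> 'b) set \<Rightarrow> 'a set \<Rightarrow> 'b set \<Rightarrow> bool" where
  "full_image R X Y \<longleftrightarrow> (\<forall>p\<in>Y. \<exists>x\<in>X. (x, p) \<in> R)"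

text \<open>The graph $G \ast R$; the target set \<open>B\<close> of the relation has to be given explicitly.\<close>

definition rel_graph ::
    "'a pair_pre_digraph \<Rightarrow> ('a \<times> 'b) set \<Rightarrow> 'b set \<Rightarrow> 'b pair_pre_digraph" where
  "rel_graph G R B =
     \<lparr> pverts = B,
       parcs = {(u, v) \<in> B \<times> B. \<exists>(x, y) \<in> parcs G. (x, u) \<in> R \<and> (y, v) \<in> R} \<rparr>"

text \<open>The equation $G \ast R = H$.\<close>

definition rel_graph_eq ::
    "'a pair_pre_digraph \<Rightarrow> ('a \<times> 'b) set \<Rightarrow> 'b pair_pre_digraph \<Rightarrow> bool" where
  "rel_graph_eq G R H \<longleftrightarrow>
     R \<subseteq> pverts G \<times> pverts H \<and> full_image R (pverts G) (pverts H) \<and> rel_graph G R (pverts H) = H"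

definition weak_rel_equiv :: "'a pair_pre_digraph \<Rightarrow> 'b pair_pre_digraph \<Rightarrow> bool" where
  "weak_rel_equiv G H \<longleftrightarrow>
     (\<exists>R S. full_domain R (pverts G) (pverts H) \<and> full_domain S (pverts H) (pverts G) \<and>
            rel_graph_eq G R H \<and> rel_graph_eq H S G)"

text \<open>
  A definition cannot quantify over graphs on all vertex types, so competing graphs have vertices
  in \<open>nat\<close>. As graphs are finite, this loses nothing: see \<open>R_core_card_le\<close> below.
\<close>

definition R_core :: "'a pair_pre_digraph \<Rightarrow> bool" where
  "R_core G \<longleftrightarrow>
     (\<forall>K :: nat pair_pre_digraph. pair_pseudo_graph K \<longrightarrow> weak_rel_equiv G K \<longrightarrow>
        card (pverts G) \<le> card (pverts K))"

lemma weak_rel_equiv_relabel: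
  fixes f :: "'c \<Rightarrow> 'd"
  assumes K: "pair_pseudo_graph K" and inj: "inj_on f (pverts K)" and eq: "weak_rel_equiv G K"
  defines "K' \<equiv> \<lparr> pverts = f ` pverts K, parcs = map_prod f f ` parcs K \<rparr>"
  shows "pair_pseudo_graph K'" and "weak_rel_equiv G K'"
proof -
  interpret pair_pseudo_graph K by fact
  have sym: "(y, x) \<in> parcs K" if "(x, y) \<in> parcs K" for x y
    using pair_sym_arcs that by (auto simp: symmetric_def dest: symD)
  show "pair_pseudo_graph K'"
  proof
    show "symmetric (with_proj K')"
      unfolding symmetric_def sym_def K'_def by (auto intro: sym rev_image_eqI)
  qed (auto simp: K'_def pair_finite_verts pair_finite_arcs dest: in_arcsD1 in_arcsD2)
  obtain R S where RS: "full_domain R (pverts G) (pverts K)" "full_domain S (pverts K) (pverts G)"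
      "rel_graph_eq G R K" "rel_graph_eq K S G"
    using eq unfolding weak_rel_equiv_def by blast
  define R' where "R' = {(x, f p) | x p. (x, p) \<in> R}"
  define S' where "S' = {(f p, x) | x p. (p, x) \<in> S}"
  have sub: "R \<subseteq> pverts G \<times> pverts K" "S \<subseteq> pverts K \<times> pverts G"
    using RS by (auto simp: rel_graph_eq_def)
  have R': "(x, f p) \<in> R' \<longleftrightarrow> (x, p) \<in> R" if "p \<in> pverts K" for x p
    using that sub inj by (auto simp: R'_def dest: inj_onD)
  have S': "(f p, x) \<in> S' \<longleftrightarrow> (p, x) \<in> S" if "p \<in> pverts K" for x p
    using that sub inj by (auto simp: S'_def dest: inj_onD)
  have arcsK: "parcs K = {(u, v) \<in> pverts K \<times> pverts K.
      \<exists>(x, y) \<in> parcs G. (x, u) \<in> R \<and> (y, v) \<in> R}"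
  proof -
    have "parcs (rel_graph G R (pverts K)) = parcs K"
      using RS(3) by (simp add: rel_graph_eq_def)
    then show ?thesis by (simp only: rel_graph_def pair_pre_digraph.simps)
  qed
  have arcsG: "parcs G = {(u, v) \<in> pverts G \<times> pverts G.
      \<exists>(x, y) \<in> parcs K. (x, u) \<in> S \<and> (y, v) \<in> S}"
  proof -
    have "parcs (rel_graph K S (pverts G)) = parcs G"
      using RS(4) by (simp add: rel_graph_eq_def)
    then show ?thesis by (simp only: rel_graph_def pair_pre_digraph.simps)
  qed
  have "{(u, v) \<in> f ` pverts K \<times> f ` pverts K. \<exists>(x, y) \<in> parcs G. (x, u) \<in> R' \<and> (y, v) \<in> R'}
      = map_prod f f ` parcs K" (is "?L = ?M")
  proof (intro set_eqI iffI)
    fix e assume "e \<in> ?L"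
    then obtain u v x y where "e = (f u, f v)" "u \<in> pverts K" "v \<in> pverts K"
      "(x, y) \<in> parcs G" "(x, u) \<in> R" "(y, v) \<in> R" by (auto simp: R')
    moreover from this have "(u, v) \<in> parcs K" by (subst arcsK) blast
    ultimately show "e \<in> ?M" by force
  next
    fix e assume "e \<in> ?M"
    then obtain u v where uv: "e = (f u, f v)" "(u, v) \<in> parcs K" by auto
    from uv(2) have "u \<in> pverts K" "v \<in> pverts K" "\<exists>(x, y) \<in> parcs G. (x, u) \<in> R \<and> (y, v) \<in> R"
      by (subst (asm) arcsK, blast)+
    then show "e \<in> ?L" using uv(1) by (auto simp: R')
  qed
  moreover have "{(u, v) \<in> pverts G \<times> pverts G.
      \<exists>(x, y) \<in> map_prod f f ` parcs K. (x, u) \<in> S' \<and> (y, v) \<in> S'} = parcs G"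
  proof -
    have "(\<exists>(x, y) \<in> map_prod f f ` parcs K. (x, u) \<in> S' \<and> (y, v) \<in> S')
        \<longleftrightarrow> (\<exists>(x, y) \<in> parcs K. (x, u) \<in> S \<and> (y, v) \<in> S)" for u v
    proof -
      have "(case map_prod f f e of (x, y) \<Rightarrow> (x, u) \<in> S' \<and> (y, v) \<in> S')
          \<longleftrightarrow> (case e of (x, y) \<Rightarrow> (x, u) \<in> S \<and> (y, v) \<in> S)" if "e \<in> parcs K" for e
        using that S' in_arcsD1 in_arcsD2 by (cases e) simp
      then show ?thesis by (simp only: bex_simps) (rule bex_cong, simp_all)
    qed
    then show ?thesis by (simp only: arcsG[symmetric])
  qed
  ultimately have "rel_graph G R' (pverts K') = K'" "rel_graph K' S' (pverts G) = G"
    by (simp_all only: rel_graph_def K'_def pair_pre_digraph.simps) simp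
  moreover have "R' \<subseteq> pverts G \<times> pverts K'" "S' \<subseteq> pverts K' \<times> pverts G"
    using sub by (auto simp: R'_def S'_def K'_def)
  moreover have "full_image R' (pverts G) (pverts K')" "full_image S' (pverts K') (pverts G)"
    using RS by (auto simp: rel_graph_eq_def full_image_def K'_def R' S')
  moreover have "full_domain R' (pverts G) (pverts K')" "full_domain S' (pverts K') (pverts G)"
    using RS by (auto simp: full_domain_def K'_def R' S')
  ultimately show "weak_rel_equiv G K'" unfolding weak_rel_equiv_def rel_graph_eq_def by blast
qed

lemma R_core_card_le:
  fixes G :: "'a pair_pre_digraph" and K :: "'c pair_pre_digraph"
  assumes "R_core G" "pair_pseudo_graph K" "weak_rel_equiv G K"
  shows "card (pverts G) \<le> card (pverts K)"
proof -
  interpret pair_pseudo_graph K by fact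
  obtain f :: "'c \<Rightarrow> nat" where f: "inj_on f (pverts K)"
    using finite_imp_inj_to_nat_seg[OF pair_finite_verts] by blast
  have "card (pverts G) \<le> card (f ` pverts K)"
    using assms(1) weak_rel_equiv_relabel[OF assms(2) f assms(3)]
    by (fastforce simp: R_core_def)
  then show ?thesis using card_image[OF f] by simp
qed

end

(* Composing the two relations gives a relation T on the vertices of G with G * T = G, and some power E
   of T is idempotent. Picking one vertex from each class of mutually E-related loops of E splits
   E through a graph on these representatives that is equivalent to G; as G is an R-core, the
   representatives exhaust the vertices, so E is a partial order. Reflexivity of E
   provides, for each vertex x of G, a vertex f x of H with x related to f x and back;
   antisymmetry makes f injective, and f preserves and reflects edges. *)
theory Submission
  imports Defs
begin

text \<open>By the pigeonhole principle two positive powers of \<open>T\<close> coincide, so the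
  powers are periodic from some exponent on. A multiple of the period lying in the periodic range is
  then unchanged by doubling.\<close>

lemma finite_relpow_idempotent:
  fixes T :: "'a rel"
  assumes "finite T"
  obtains k where "k > 0" "T ^^ k O T ^^ k = T ^^ k"
proof -
  \<comment> \<open>Positive exponents only: \<open>T ^^ 0\<close> is the identity on the whole
    type, which need not be finite.\<close>
  have "T ^^ n \<subseteq> Field T \<times> Field T" if "n > 0" for n
    using that by (induction n rule: nat_induct_non_zero) (auto simp: Field_def)
  then have "(\<lambda>n. T ^^ n) ` {0<..} \<subseteq> Pow (Field T \<times> Field T)"
    by auto
  moreover have "finite (Pow (Field T \<times> Field T))"
    using assms by (simp add: finite_Field)
  ultimately have "finite ((\<lambda>n. T ^^ n) ` {0<..})"
    by (rule finite_subset)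
  then have "\<not> inj_on (\<lambda>n. T ^^ n) {0<..}"
    using finite_imageD infinite_Ioi by blast
  then obtain i j where ij: "0 < i" "i < j" "T ^^ i = T ^^ j"
    by (auto simp: inj_on_def) (metis nat_neq_iff)
  define p where "p = j - i"
  have p: "p > 0" "T ^^ (i + p) = T ^^ i"
    using ij by (auto simp: p_def)
  have period: "T ^^ (i + q + m * p) = T ^^ (i + q)" for q m
  proof (induction m)
    case (Suc m)
    have "i + q + Suc m * p = (i + p) + (q + m * p)" by simp
    then have "T ^^ (i + q + Suc m * p) = T ^^ i O T ^^ (q + m * p)"
      by (simp only: relpow_add[of "i + p"] p)
    also have "\<dots> = T ^^ (i + q + m * p)"
      by (simp only: relpow_add[symmetric] add.assoc)
    finally show ?case using Suc by simp
  qed simp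
  \<comment> \<open>The exponent \<open>i * p\<close> is past the threshold \<open>i\<close>, and
    doubling it adds \<open>i\<close> full periods.\<close>
  have "i \<le> i * p" using p by simp
  then obtain q where "i * p = i + q" using le_Suc_ex by blast
  then have "T ^^ (i * p) O T ^^ (i * p) = T ^^ (i * p)"
    using period[of q i] by (simp only: relpow_add[symmetric])
  with that[of "i * p"] ij p show thesis by simp
qed

text \<open>Idempotence lets every \<open>E\<close>-step be subdivided again and again. Among
  finitely many intermediate points this forces a cycle, which transitivity contracts to a
  loop.\<close>

lemma idempotent_rel_loop:
  assumes "finite E" "E O E = E" "(x, y) \<in> E"
  obtains z where "(x, z) \<in> E" "(z, z) \<in> E" "(z, y) \<in> E"
proof -
  have trans: "trans E" using assms(2) by (auto simp: trans_def)
  define A where "A = {z. (x, z) \<in> E \<and> (z, y) \<in> E}"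
  have "(x, y) \<in> E O E" using assms(2,3) by simp
  then have "A \<noteq> {}" by (auto simp: A_def)
  have step: "\<exists>z'\<in>A. (z, z') \<in> E" if "z \<in> A" for z
  proof -
    have "(z, y) \<in> E O E" using that assms(2) by (simp add: A_def)
    then show ?thesis using that trans by (auto simp: A_def dest: transD)
  qed
  have "\<exists>z\<in>A. (z, z) \<in> E"
  proof (rule ccontr)
    assume no_loop: "\<not> ?thesis"
    \<comment> \<open>Without loops, \<open>E\<close> restricted to \<open>A\<close> would be a
      finite strict order; a maximal element of it contradicts \<open>step\<close>.\<close>
    let ?F = "E \<inter> A \<times> A"
    have "trans ?F" using trans by (auto simp: trans_def)
    then have "acyclic ?F"
      using no_loop by (auto simp: acyclic_def)
    then have "wf (?F\<inverse>)" using assms(1) by (simp add: finite_acyclic_wf_converse)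
    with \<open>A \<noteq> {}\<close> obtain m where "m \<in> A" "\<And>z. (z, m) \<in> ?F\<inverse> \<Longrightarrow> z \<notin> A"
      by (metis wfE_min equals0I)
    then show False using step by blast
  qed
  then show thesis using that by (auto simp: A_def)
qed

text \<open>The assumption keeps every intermediate vertex of a composite pair inside
  \<open>B\<close>, so passing through the graph on \<open>B\<close> loses no edge.\<close>

lemma rel_graph_comp:
  assumes "R \<subseteq> A \<times> B"
  shows "rel_graph G (R O S) C = rel_graph (rel_graph G R B) S C"
  using assms by (fastforce simp: rel_graph_def)

lemma rel_graph_eq_comp:
  assumes "rel_graph_eq G R H" "rel_graph_eq H S K"
  shows "rel_graph_eq G (R O S) K"
proof -
  have RS: "R \<subseteq> pverts G \<times> pverts H" "S \<subseteq> pverts H \<times> pverts K"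
    and eqs: "rel_graph G R (pverts H) = H" "rel_graph H S (pverts K) = K"
    using assms by (auto simp: rel_graph_eq_def)
  have "rel_graph G (R O S) (pverts K) = rel_graph (rel_graph G R (pverts H)) S (pverts K)"
    using RS(1) by (rule rel_graph_comp)
  then have "rel_graph G (R O S) (pverts K) = K" by (simp only: eqs)
  moreover have "full_image (R O S) (pverts G) (pverts K)"
    using assms by (fastforce simp: rel_graph_eq_def full_image_def)
  ultimately show ?thesis using RS by (auto simp: rel_graph_eq_def)
qed

lemma full_domain_comp:
  "full_domain R X Y \<Longrightarrow> full_domain S Y Z \<Longrightarrow> full_domain (R O S) X Z"
  unfolding full_domain_def by blast

lemma rel_graph_eq_relpow:
  assumes "rel_graph_eq G T G" "n > 0"
  shows "rel_graph_eq G (T ^^ n) G"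
  using assms(2)
  by (induction n rule: nat_induct_non_zero) (auto intro: rel_graph_eq_comp assms)

lemma full_domain_relpow:
  assumes "full_domain T X X"
  shows "full_domain (T ^^ n) X X"
proof (induction n)
  case 0
  show ?case by (auto simp: full_domain_def)
qed (auto intro: full_domain_comp assms)

lemma rel_graph_eq_arc:
  assumes "rel_graph_eq G R H" "(x, y) \<in> parcs G" "(x, u) \<in> R" "(y, v) \<in> R"
  shows "(u, v) \<in> parcs H"
proof -
  have "u \<in> pverts H" "v \<in> pverts H"
    using assms by (auto simp: rel_graph_eq_def)
  then have "(u, v) \<in> parcs (rel_graph G R (pverts H))"
    using assms(2-) by (auto simp: rel_graph_def)
  then show ?thesis using assms(1) by (simp add: rel_graph_eq_def)
qed

lemma pair_pseudo_graph_rel_graph: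
  assumes "pair_pseudo_graph G" "finite B"
  shows "pair_pseudo_graph (rel_graph G R B)"
proof -
  interpret pair_pseudo_graph G by fact
  have sym: "(y, x) \<in> parcs G" if "(x, y) \<in> parcs G" for x y
    using pair_sym_arcs that by (auto simp: symmetric_def dest: symD)
  have sub: "parcs (rel_graph G R B) \<subseteq> B \<times> B" by (auto simp: rel_graph_def)
  show ?thesis
  proof
    show "finite (parcs (rel_graph G R B))"
      using sub by (rule finite_subset) (simp add: assms(2))
    show "symmetric (with_proj (rel_graph G R B))"
      unfolding symmetric_def sym_def rel_graph_def by (auto dest: sym)
  qed (use sub assms(2) in \<open>auto simp: rel_graph_def\<close>)
qed

lemma R_core_idempotent_rel:
  assumes G: "pair_pseudo_graph G" "R_core G"
    and E: "rel_graph_eq G E G" "full_domain E (pverts G) (pverts G)" "E O E = E"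
  shows "refl_on (pverts G) E" "antisym E"
proof -
  interpret pair_pseudo_graph G by fact
  let ?V = "pverts G"
  have sub: "E \<subseteq> ?V \<times> ?V" using E(1) by (simp add: rel_graph_eq_def)
  then have fin: "finite E" by (rule finite_subset) (simp add: pair_finite_verts)
  have trans: "trans E" using E(3) by (auto simp: trans_def)
  define L where "L = {z. (z, z) \<in> E}"
  \<comment> \<open>Mutually related points satisfy the same predicate, so \<open>SOME\<close> picks
    the same representative for both. Off \<open>L\<close> the predicate is unsatisfiable and the
    value arbitrary, hence \<open>W\<close> is the image of \<open>L\<close> only.\<close>
  define w where "w z = (SOME b. (z, b) \<in> E \<and> (b, z) \<in> E)" for z
  define W where "W = w ` L"
  have w: "(z, w z) \<in> E" "(w z, z) \<in> E" if "z \<in> L" for z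
    using someI[of "\<lambda>b. (z, b) \<in> E \<and> (b, z) \<in> E" z] that by (auto simp: w_def L_def)
  have w_eq: "w a = w b" if "(a, b) \<in> E" "(b, a) \<in> E" for a b
  proof -
    have "((a, c) \<in> E \<and> (c, a) \<in> E) = ((b, c) \<in> E \<and> (c, b) \<in> E)" for c
      using that trans by (meson transD)
    then show ?thesis by (simp add: w_def)
  qed
  have W_loop: "(z, z) \<in> E" if "z \<in> W" for z
  proof -
    from that obtain a where "a \<in> L" "z = w a" by (auto simp: W_def)
    then show ?thesis using transD[OF trans w(2) w(1)] by simp
  qed
  have WV: "W \<subseteq> ?V" using W_loop sub by blast
  have via_W: "\<exists>z\<in>W. (x, z) \<in> E \<and> (z, y) \<in> E" if xy: "(x, y) \<in> E" for x y
  proof -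
    \<comment> \<open>The loop \<open>z\<close> between \<open>x\<close> and \<open>y\<close> can be
      exchanged for its representative \<open>w z\<close>, since the two are mutually
      related.\<close>
    obtain z where z: "(x, z) \<in> E" "(z, z) \<in> E" "(z, y) \<in> E"
      by (rule idempotent_rel_loop[OF fin E(3) xy])
    then have "z \<in> L" by (simp add: L_def)
    then have "w z \<in> W" by (simp add: W_def)
    moreover have "(x, w z) \<in> E" by (rule transD[OF trans z(1) w(1)]) fact
    moreover have "(w z, y) \<in> E" by (rule transD[OF trans w(2) z(3)]) fact
    ultimately show ?thesis by blast
  qed
  \<comment> \<open>By \<open>via_W\<close>, cutting \<open>E\<close> at intermediate points in
    \<open>W\<close> gives a factorization \<open>P O Q\<close> of \<open>E\<close>;
    \<open>K\<close> is the graph reached halfway.\<close>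
  define P where "P = E \<inter> ?V \<times> W"
  define Q where "Q = E \<inter> W \<times> ?V"
  define K where "K = rel_graph G P W"
  have PQ: "P O Q = E"
  proof
    have "P O Q \<subseteq> E O E" by (auto simp: P_def Q_def)
    then show "P O Q \<subseteq> E" by (simp only: E(3))
    show "E \<subseteq> P O Q"
      using via_W sub unfolding P_def Q_def by blast
  qed
  have verts_K: "pverts K = W" by (simp add: K_def rel_graph_def)
  have "rel_graph K Q ?V = rel_graph G (P O Q) ?V"
    unfolding K_def by (rule rel_graph_comp[symmetric, of _ ?V]) (auto simp: P_def)
  also have "\<dots> = G" using E(1) by (simp add: PQ rel_graph_eq_def)
  finally have "rel_graph K Q ?V = G" .
  moreover have "full_image Q W ?V"
    using E(1) via_W unfolding rel_graph_eq_def full_image_def Q_def by blast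
  ultimately have "rel_graph_eq K Q G"
    by (auto simp: rel_graph_eq_def verts_K Q_def)
  moreover have "full_domain Q W ?V" "full_image P ?V W"
    using W_loop WV by (auto simp: full_domain_def full_image_def P_def Q_def)
  moreover have "full_domain P ?V W"
    using E(2) via_W unfolding full_domain_def P_def by blast
  moreover have "rel_graph_eq G P K"
    using \<open>full_image P ?V W\<close> unfolding rel_graph_eq_def verts_K by (auto simp: K_def P_def)
  ultimately have "weak_rel_equiv G K"
    unfolding weak_rel_equiv_def verts_K by blast
  moreover have "pair_pseudo_graph K"
    unfolding K_def using G(1) finite_subset[OF WV pair_finite_verts]
    by (rule pair_pseudo_graph_rel_graph)
  ultimately have "card ?V \<le> card W"
    using R_core_card_le[OF G(2), of K] by (simp add: verts_K)
  then have W_all: "W = ?V" using WV pair_finite_verts card_seteq by blast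
  then show "refl_on ?V E" using W_loop sub by (auto simp: refl_on_def)
  \<comment> \<open>A member of \<open>W\<close> has the form \<open>w a\<close> with
    \<open>a\<close> in \<open>L\<close>. It is mutually related to \<open>a\<close>, so both have
    the same representative, namely \<open>w a\<close> itself.\<close>
  have w_id: "w x = x" if "x \<in> W" for x
    using that w w_eq by (auto simp: W_def)
  show "antisym E"
  proof (rule antisymI)
    fix x y assume xy: "(x, y) \<in> E" "(y, x) \<in> E"
    then have "x \<in> W" "y \<in> W" using sub W_all by auto
    then show "x = y" using w_eq[OF xy] w_id by simp
  qed
qed

text \<open>In a pair digraph an arc is its pair of endpoints, so the vertex bijection determines
  the arc map \<open>map_prod f f\<close>, and head and tail remain the projections.\<close>

lemma digraph_iso_with_projI:
  assumes "pair_wf_digraph G" "pair_wf_digraph H" "bij_betw f (pverts G) (pverts H)"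
    and arc: "\<And>x y. x \<in> pverts G \<Longrightarrow> y \<in> pverts G \<Longrightarrow>
      (f x, f y) \<in> parcs H \<longleftrightarrow> (x, y) \<in> parcs G"
  shows "digraph_iso (with_proj G) (with_proj H)"
proof -
  interpret G: pair_wf_digraph G by fact
  interpret H: pair_wf_digraph H by fact
  define h where "h = \<lparr>iso_verts = f, iso_arcs = map_prod f f, iso_head = snd, iso_tail = fst\<rparr>"
  have f: "inj_on f (pverts G)" "f ` pverts G = pverts H"
    using assms(3) by (auto simp: bij_betw_def)
  have "inj_on (map_prod f f) (parcs G)"
    by (rule inj_on_subset[OF map_prod_inj_on[OF f(1) f(1)]])
      (auto dest: G.in_arcsD1 G.in_arcsD2)
  then have "pre_digraph.digraph_isomorphism (with_proj G) h"
    using f(1) G.wf_digraph_axioms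
    by (simp add: pre_digraph.digraph_isomorphism_def h_def)
  moreover have "map_prod f f ` parcs G = parcs H"
  proof (intro equalityI subrelI)
    fix u v assume "(u, v) \<in> map_prod f f ` parcs G"
    then show "(u, v) \<in> parcs H" using arc by (auto dest: G.in_arcsD1 G.in_arcsD2)
  next
    fix u v assume uv: "(u, v) \<in> parcs H"
    then obtain x y where "x \<in> pverts G" "y \<in> pverts G" "u = f x" "v = f y"
      using f(2) H.in_arcsD1 H.in_arcsD2 by (metis imageE)
    then show "(u, v) \<in> map_prod f f ` parcs G"
      using uv arc by force
  qed
  ultimately show ?thesis
    using f(2) unfolding digraph_iso_def
    by (intro exI[of _ h]) (simp add: app_iso_def h_def with_proj_def)
qed

theorem proposition3p14:
  fixes G :: "'a pair_pre_digraph" and H :: "'b pair_pre_digraph"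
  assumes "pair_pseudo_graph G" and "pair_pseudo_graph H"
    and "R_core G" and "R_core H"
    and "weak_rel_equiv G H"
  shows "digraph_iso (with_proj G) (with_proj H)"
proof -
  interpret G: pair_pseudo_graph G by fact
  interpret H: pair_pseudo_graph H by fact
  let ?V = "pverts G"
  obtain R S where dom: "full_domain R ?V (pverts H)" "full_domain S (pverts H) ?V"
    and eq: "rel_graph_eq G R H" "rel_graph_eq H S G"
    using assms(5) by (auto simp: weak_rel_equiv_def)
  have "weak_rel_equiv H G"
    using assms(5) by (auto simp: weak_rel_equiv_def)
  \<comment> \<open>Minimality applies in both directions; equal cardinality will later upgrade
    injectivity of \<open>f\<close> to bijectivity.\<close>
  then have card: "card ?V = card (pverts H)"
    using assms by (meson R_core_card_le le_antisym)
  define T where "T = R O S"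
  have T: "rel_graph_eq G T G" "full_domain T ?V ?V"
    unfolding T_def by (rule rel_graph_eq_comp[OF eq], rule full_domain_comp[OF dom])
  then have "T \<subseteq> ?V \<times> ?V" by (simp add: rel_graph_eq_def)
  then have "finite T" by (rule finite_subset) (simp add: G.pair_finite_verts)
  then obtain k where k: "k > 0" "T ^^ k O T ^^ k = T ^^ k"
    by (rule finite_relpow_idempotent)
  define E where "E = T ^^ k"
  have E: "rel_graph_eq G E G" "full_domain E ?V ?V" "E O E = E"
    unfolding E_def using T k by (auto intro: rel_graph_eq_relpow full_domain_relpow)
  have refl: "refl_on ?V E" and anti: "antisym E"
    using R_core_idempotent_rel[OF assms(1,3) E] .
  \<comment> \<open>The exponent is one short of \<open>2 * k\<close>, and appending
    \<open>R O S\<close> supplies the missing factor \<open>T\<close>. With \<open>k - 1\<close>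
    alone it could be zero, and \<open>T ^^ 0\<close> need not stay inside the vertex set.\<close>
  define R' where "R' = T ^^ (k + (k - 1)) O R"
  have R': "rel_graph_eq G R' H"
    unfolding R'_def using k(1)
    by (intro rel_graph_eq_comp[OF rel_graph_eq_relpow[OF T(1)] eq(1)]) simp
  have "k + k = Suc (k + (k - 1))" using k by simp
  then have "T ^^ (k + k) = T ^^ (k + (k - 1)) O T"
    by (simp only: relpow.simps)
  then have R'S: "R' O S = E"
    using k by (simp add: R'_def E_def T_def O_assoc relpow_add)
  then have "\<forall>x\<in>?V. \<exists>p. (x, p) \<in> R' \<and> (p, x) \<in> S"
    using refl by (auto simp: refl_on_def)
  \<comment> \<open>The loop of \<open>E\<close> at \<open>x\<close> factors through
    \<open>H\<close>; \<open>f x\<close> is a vertex where it passes.\<close>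
  then obtain f where f: "(x, f x) \<in> R'" "(f x, x) \<in> S" if "x \<in> ?V" for x
    by metis
  have "inj_on f ?V"
  proof (rule inj_onI)
    fix x y assume "x \<in> ?V" "y \<in> ?V" "f x = f y"
    \<comment> \<open>At the common vertex, the route out of \<open>x\<close> can be continued by
      the return to \<open>y\<close>, and vice versa.\<close>
    then have "(x, y) \<in> R' O S" "(y, x) \<in> R' O S" using f by (metis relcomp.relcompI)+
    then show "x = y" using R'S anti by (auto dest: antisymD)
  qed
  moreover have "f ` ?V \<subseteq> pverts H"
    using f(1) R' by (auto simp: rel_graph_eq_def)
  ultimately have "bij_betw f ?V (pverts H)"
    using card H.pair_finite_verts by (simp add: bij_betw_def card_image card_subset_eq)
  with G.pair_wf_digraph_axioms H.pair_wf_digraph_axioms show ?thesis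
  proof (rule digraph_iso_with_projI)
    fix x y assume "x \<in> ?V" "y \<in> ?V"
    note f = f[OF this(1)] f[OF this(2)]
    \<comment> \<open>\<open>R'\<close> transports edges of \<open>G\<close> forward along
      \<open>f\<close>, and \<open>S\<close> transports edges of \<open>H\<close> back.\<close>
    show "(f x, f y) \<in> parcs H \<longleftrightarrow> (x, y) \<in> parcs G"
      using rel_graph_eq_arc[OF R' _ f(1) f(3)] rel_graph_eq_arc[OF eq(2) _ f(2) f(4)] by blast
  qed
qed

end
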